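(* Let $M$ be a DFA with $n$ states. If $L(M)$ is not prefix-convex, then there exists a witness $(u,v,w)$ to the failure of prefix-convexity with $|w| \le 2n - 1$. Furthermore, this bound is best possible: for every $n \ge 2$ there exists a DFA with $n$ states over a one-letter alphabet whose language is not prefix-convex and for which every witness $(u,v,w)$ satisfies $|w| \ge 2n-1$.
   Context: A word $u$ is a prefix of $v$ if $v = ux$ for some word $x$. A witness to the failure of prefix-convexity of $L$ is a triple $(u,v,w)$ with $u,w \in L$, $v \notin L$, $u$ a prefix of $v$ and $v$ a prefix of $w$. $L$ is prefix-convex iff no witness exists. *)

theory Defs
  imports Main "HOL-Library.Sublist"
begin

record ('q, 'a) automaton =
  states :: "'q set"
  alphabet :: "'a set"
  step :: "'q \<Rightarrow> 'a \<Rightarrow> 'q"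
  init :: 'q
  final :: "'q set"

text \<open>Automata are complete: the transition function is total on states and letters.
  Its values outside \<open>states M \<times> alphabet M\<close> are irrelevant.\<close>

locale dfa =
  fixes M :: "('q, 'a) automaton"
  assumes finite_states: "finite (states M)"
    and finite_alphabet: "finite (alphabet M)"
    and init_in: "init M \<in> states M"
    and final_subset: "final M \<subseteq> states M"
    and step_closed: "\<And>q a. q \<in> states M \<Longrightarrow> a \<in> alphabet M \<Longrightarrow> step M q a \<in> states M"

definition dfa_lang :: "('q, 'a) automaton \<Rightarrow> 'a list set" where
  "dfa_lang M = {w \<in> lists (alphabet M). foldl (step M) (init M) w \<in> final M}"

definition convexity_failure_witness :: "'a list set \<Rightarrow> 'a list \<Rightarrow> 'a list \<Rightarrow> 'a list \<Rightarrow> bool" where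
  "convexity_failure_witness L u v w \<longleftrightarrow>
     u \<in> L \<and> w \<in> L \<and> v \<notin> L \<and> prefix u v \<and> prefix v w"

definition prefix_convex :: "'a list set \<Rightarrow> bool" where
  "prefix_convex L \<longleftrightarrow> (\<nexists>u v w. convexity_failure_witness L u v w)"

end

theory Submission
  imports Defs
begin

text \<open>Take a witness \<open>(u, v, w)\<close> with \<open>w\<close> as short as possible, then \<open>u\<close> and after it \<open>v\<close> as
  short as possible. Along the run of \<open>w\<close>, the states before \<open>u\<close> are non-final, those from \<open>u\<close> up to
  \<open>v\<close> are final, and those from \<open>v\<close> up to \<open>w\<close> are non-final. Inside each of the three segments no
  state repeats, since a loop could be cut out to shorten \<open>w\<close>. With \<open>f \<ge> 1\<close> final states this gives
  \<open>length w \<le> (n - f) + f + (n - f) \<le> 2 * n - 1\<close>. The bound is attained by the cycle of length \<open>n\<close>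
  whose only final state is the predecessor of the initial one.\<close>

lemma take_in_dfa_lang:
  assumes "w \<in> lists (alphabet M)"
  shows "take k w \<in> dfa_lang M \<longleftrightarrow> foldl (step M) (init M) (take k w) \<in> final M"
  using assms set_take_subset[of k w] by (auto simp: dfa_lang_def)

lemma (in dfa) run_in_states:
  assumes "w \<in> lists (alphabet M)" "q \<in> states M"
  shows "foldl (step M) q w \<in> states M"
  using assms by (induction w arbitrary: q) (auto simp: step_closed)

text \<open>The letters from position \<open>j\<close> to \<open>k\<close> are read from the same
  state whether \<open>take i w\<close> or \<open>take j w\<close> came first.\<close>

lemma foldl_take_cut:
  assumes "foldl f q (take i w) = foldl f q (take j w)" "j \<le> k"
  shows "foldl f q (take i w @ take (k - j) (drop j w)) = foldl f q (take k w)"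
proof -
  have "take k w = take j w @ take (k - j) (drop j w)"
    using assms(2) by (metis le_add_diff_inverse take_add)
  with assms(1) show ?thesis by simp
qed

text \<open>Positions in \<open>w\<close> replace the prefixes \<open>u\<close> and
  \<open>v\<close>, so that minimising a witness and cutting loops out of it become arithmetic on
  indices.\<close>

lemma convexity_failure_witness_iff_take:
  "convexity_failure_witness L u v w \<longleftrightarrow>
     (\<exists>a b. a \<le> b \<and> b \<le> length w \<and> u = take a w \<and> v = take b w \<and>
        take a w \<in> L \<and> take b w \<notin> L \<and> w \<in> L)"
proof
  assume wit: "convexity_failure_witness L u v w"
  then have "prefix u v" "prefix v w" "prefix u w"
    unfolding convexity_failure_witness_def by auto
  then have "u = take (length u) w" "v = take (length v) w"
    "length u \<le> length v" "length v \<le> length w"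
    by (auto simp: prefix_def)
  with wit show "\<exists>a b. a \<le> b \<and> b \<le> length w \<and> u = take a w \<and> v = take b w \<and>
        take a w \<in> L \<and> take b w \<notin> L \<and> w \<in> L"
    unfolding convexity_failure_witness_def by metis
next
  assume "\<exists>a b. a \<le> b \<and> b \<le> length w \<and> u = take a w \<and> v = take b w \<and>
        take a w \<in> L \<and> take b w \<notin> L \<and> w \<in> L"
  then obtain a b where ab: "a \<le> b" "u = take a w" "v = take b w"
    "take a w \<in> L" "take b w \<notin> L" "w \<in> L" by blast
  then have "u = take a v" by (simp add: min_absorb1)
  then have "prefix u v" by (metis take_is_prefix)
  with ab show "convexity_failure_witness L u v w"
    unfolding convexity_failure_witness_def by (simp add: take_is_prefix)
qed

text \<open>Removing a loop changes no state reached outside it. By \<open>outside\<close>, neither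
  \<open>a\<close> nor \<open>b\<close> lies strictly inside the loop, so both positions survive
  with their acceptance status.\<close>

lemma cut_convexity_failure_witness:
  assumes w: "w \<in> dfa_lang M"
    and ab: "a \<le> b" "b \<le> length w" "take a w \<in> dfa_lang M" "take b w \<notin> dfa_lang M"
    and ij: "i < j" "j \<le> length w"
    and loop: "foldl (step M) (init M) (take i w) = foldl (step M) (init M) (take j w)"
    and outside: "a \<le> i \<or> j \<le> a" "b \<le> i \<or> j \<le> b"
  shows "\<exists>u v. convexity_failure_witness (dfa_lang M) u v (take i w @ drop j w)"
proof -
  let ?x = "take i w @ drop j w"
  \<comment> \<open>\<open>g\<close> carries a position of \<open>w\<close> outside the loop to the
    matching position of \<open>?x\<close>; both ends \<open>i\<close> and \<open>j\<close> of the
    loop go to \<open>i\<close>.\<close>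
  define g where "g k = (if k \<le> i then k else i + (k - j))" for k
  have wl: "w \<in> lists (alphabet M)" using w by (simp add: dfa_lang_def)
  then have xl: "?x \<in> lists (alphabet M)"
    using set_take_subset[of i w] set_drop_subset[of j w] by auto
  have run: "foldl (step M) (init M) (take (g k) ?x) = foldl (step M) (init M) (take k w)"
    if "k \<le> i \<or> j \<le> k" for k
  proof (cases "k \<le> i")
    case True
    then show ?thesis using ij by (simp add: g_def min_absorb1)
  next
    case False
    then have "take (g k) ?x = take i w @ take (k - j) (drop j w)"
      using ij by (simp add: g_def)
    then show ?thesis using foldl_take_cut[OF loop, of k] that False by simp
  qed
  have mem: "take (g k) ?x \<in> dfa_lang M \<longleftrightarrow> take k w \<in> dfa_lang M" if "k \<le> i \<or> j \<le> k" for k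
    using take_in_dfa_lang[OF xl] take_in_dfa_lang[OF wl] run[OF that] by simp
  \<comment> \<open>The whole word counts as the prefix at position \<open>length w\<close>, so
    \<open>mem\<close> also gives acceptance of \<open>?x\<close>.\<close>
  have "take (g (length w)) ?x = ?x"
    using ij by (simp add: g_def)
  then have "?x \<in> dfa_lang M"
    using mem[of "length w"] w ij by simp
  moreover have "g a \<le> g b" "g b \<le> length ?x"
    using ab ij outside by (auto simp: g_def)
  moreover have "take (g a) ?x \<in> dfa_lang M" "take (g b) ?x \<notin> dfa_lang M"
    using mem ab outside by auto
  ultimately show ?thesis
    unfolding convexity_failure_witness_iff_take by blast
qed

lemma (in dfa) short_convexity_failure_witness:
  assumes "\<not> prefix_convex (dfa_lang M)"
  shows "\<exists>u v w. convexity_failure_witness (dfa_lang M) u v w \<and>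
           length w \<le> 2 * card (states M) - 1"
proof -
  let ?L = "dfa_lang M"
  define P where "P x \<longleftrightarrow> (\<exists>u v. convexity_failure_witness ?L u v x)" for x
  have "\<exists>x. P x" using assms by (auto simp: prefix_convex_def P_def)
  then obtain w where Pw: "P w" and minw: "\<And>x. P x \<Longrightarrow> length w \<le> length x"
    using ex_has_least_nat[of P _ length] by blast
  from Pw obtain a0 b0 where 0: "a0 \<le> b0" "b0 \<le> length w" "take a0 w \<in> ?L" "take b0 w \<notin> ?L" "w \<in> ?L"
    unfolding P_def convexity_failure_witness_iff_take by blast
  \<comment> \<open>The minimum is over all accepted prefixes; since \<open>a \<le> a0\<close>, the
    rejected position \<open>b0\<close> still comes after \<open>a\<close>.\<close>
  define a where "a = (LEAST k. take k w \<in> ?L)"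
  have aL: "take a w \<in> ?L" unfolding a_def by (rule LeastI) (rule 0)
  have a_le: "a \<le> a0" unfolding a_def by (rule Least_le) (rule 0)
  have before_a: "take k w \<notin> ?L" if "k < a" for k
    using that unfolding a_def by (rule not_less_Least)
  define b where "b = (LEAST k. a \<le> k \<and> take k w \<notin> ?L)"
  have b0: "a \<le> b0 \<and> take b0 w \<notin> ?L" using 0 a_le by auto
  have bL: "a \<le> b" "take b w \<notin> ?L"
    using LeastI[of "\<lambda>k. a \<le> k \<and> take k w \<notin> ?L", OF b0] unfolding b_def by auto
  have "b \<le> b0" unfolding b_def by (rule Least_le) (rule b0)
  then have bw: "b \<le> length w" using 0 by simp
  have before_b: "take k w \<in> ?L" if "a \<le> k" "k < b" for k
    using that not_less_Least[of k "\<lambda>k. a \<le> k \<and> take k w \<notin> ?L"] unfolding b_def by auto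
  \<comment> \<open>An accepted proper prefix reaching at least to \<open>b\<close> would, with the
    same \<open>a\<close> and \<open>b\<close>, end a shorter witness.\<close>
  have after_b: "take k w \<notin> ?L" if "b \<le> k" "k < length w" for k
  proof
    assume "take k w \<in> ?L"
    moreover have "take a (take k w) \<in> ?L" "take b (take k w) \<notin> ?L"
      using aL bL that by (simp_all add: min_absorb1)
    moreover have "b \<le> length (take k w)" using that by simp
    ultimately have "P (take k w)"
      unfolding P_def convexity_failure_witness_iff_take using bL(1) by blast
    from minw[OF this] that show False by simp
  qed
  define r where "r k = foldl (step M) (init M) (take k w)" for k
  have wl: "w \<in> lists (alphabet M)" using 0 by (simp add: dfa_lang_def)
  have rS: "r k \<in> states M" for k
    unfolding r_def by (rule run_in_states) (use wl set_take_subset[of k w] init_in in auto)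
  have rF: "r k \<in> final M \<longleftrightarrow> take k w \<in> ?L" for k
    using take_in_dfa_lang[OF wl] by (simp add: r_def)
  have distinct: "r i \<noteq> r j"
    if "i < j" "j \<le> length w" "a \<le> i \<or> j \<le> a" "b \<le> i \<or> j \<le> b" for i j
  proof
    assume "r i = r j"
    then have "P (take i w @ drop j w)"
      unfolding P_def r_def
      using cut_convexity_failure_witness[OF 0(5) bL(1) bw aL bL(2) that(1,2) _ that(3,4)] by blast
    from minw[OF this] that show False by simp
  qed
  \<comment> \<open>A loop within one segment has neither \<open>a\<close> nor \<open>b\<close>
    strictly inside, as \<open>distinct\<close> requires. The last segment omits position
    \<open>length w\<close>, whose state is final.\<close>
  have inj: "inj_on r {0..<a}" "inj_on r {a..<b}" "inj_on r {b..<length w}"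
    by (rule linorder_inj_onI'; use distinct bL bw in auto)+
  let ?F = "card (final M)" and ?N = "card (states M - final M)"
  have "card {0..<a} \<le> ?N"
    by (rule card_inj_on_le[OF inj(1)]) (use rS rF before_a finite_states in auto)
  moreover have "card {a..<b} \<le> ?F"
    by (rule card_inj_on_le[OF inj(2)])
      (use rF before_b finite_subset[OF final_subset finite_states] in auto)
  moreover have "card {b..<length w} \<le> ?N"
    by (rule card_inj_on_le[OF inj(3)]) (use rS rF after_b finite_states in auto)
  \<comment> \<open>The segments give \<open>length w \<le> 2 * ?N + ?F\<close>, which is
    \<open>2 * card (states M) - ?F\<close>; one final state then yields the bound.\<close>
  moreover have "?F > 0"
    using rF[of a] aL finite_subset[OF final_subset finite_states] card_gt_0_iff by blast
  moreover have "?N + ?F = card (states M)"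
    using final_subset finite_states
    by (metis card_Diff_subset card_mono finite_subset le_add_diff_inverse2)
  ultimately have "length w \<le> 2 * card (states M) - 1"
    using bL(1) bw by simp
  with Pw show ?thesis unfolding P_def by blast
qed

text \<open>The letter type is arbitrary, so \<open>undefined\<close> serves as the single
  letter.\<close>

definition cycle_dfa :: "nat \<Rightarrow> (nat, 'b) automaton" where
  "cycle_dfa n = \<lparr>states = {..<n}, alphabet = {undefined}, step = (\<lambda>q _. Suc q mod n),
     init = 0, final = {n - 1}\<rparr>"

lemma dfa_cycle_dfa: "n > 0 \<Longrightarrow> dfa (cycle_dfa n)"
  by unfold_locales (auto simp: cycle_dfa_def)

text \<open>Writing the start state as \<open>q mod n\<close> lets the induction continue with
  \<open>Suc q\<close> after one letter.\<close>

lemma foldl_Suc_mod: "foldl (\<lambda>q _. Suc q mod n) (q mod n) w = (q + length w) mod (n :: nat)"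
proof (induction w arbitrary: q)
  case (Cons x w)
  then show ?case using Cons[of "Suc q"] by (simp add: mod_Suc_eq)
qed simp

lemma dfa_lang_cycle_dfa:
  "w \<in> dfa_lang (cycle_dfa n) \<longleftrightarrow> w \<in> lists {undefined} \<and> length w mod n = n - 1"
  using foldl_Suc_mod[of n 0 w] by (simp add: dfa_lang_def cycle_dfa_def)

lemma not_prefix_convex_cycle_dfa:
  assumes "n \<ge> 2"
  shows "\<not> prefix_convex (dfa_lang (cycle_dfa n :: (nat, 'b) automaton))"
proof -
  \<comment> \<open>The witness has lengths \<open>n - 1\<close>, \<open>n\<close> and
    \<open>2 * n - 1\<close>. The middle word returns to state 0, which is not final because
    \<open>n \<ge> 2\<close>.\<close>
  let ?w = "replicate (2 * n - 1) (undefined :: 'b)"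
  have "2 * n - 1 = (n - 1) + n" using assms by simp
  then have "(2 * n - 1) mod n = n - 1"
    using assms by (metis diff_less less_le_trans mod_add_self2 mod_less zero_less_numeral zero_less_one)
  then have "n - 1 \<le> n" "n \<le> length ?w" "take (n - 1) ?w \<in> dfa_lang (cycle_dfa n)"
    "take n ?w \<notin> dfa_lang (cycle_dfa n)" "?w \<in> dfa_lang (cycle_dfa n)"
    using assms by (auto simp: dfa_lang_cycle_dfa)
  then show ?thesis
    unfolding prefix_convex_def convexity_failure_witness_iff_take by blast
qed

text \<open>Accepted lengths are congruent to \<open>n - 1\<close> modulo \<open>n\<close>. As
  \<open>u\<close> is accepted and strictly shorter than \<open>w\<close>, the length of
  \<open>w\<close> is not the least of these, and the next one is \<open>2 * n - 1\<close>.\<close>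

lemma cycle_dfa_witness_length:
  assumes "n > 0" "convexity_failure_witness (dfa_lang (cycle_dfa n)) u v w"
  shows "2 * n - 1 \<le> length w"
proof -
  have uw: "length u mod n = n - 1" "length w mod n = n - 1"
    and "prefix u v" "prefix v w" "u \<noteq> v"
    using assms(2) by (auto simp: convexity_failure_witness_def dfa_lang_cycle_dfa)
  then have less: "length u < length w"
    by (metis prefix_length_less prefix_length_le less_le_trans strict_prefix_def)
  have "length w div n \<noteq> 0"
  proof
    assume "length w div n = 0"
    then have "length w = n - 1" using uw(2) div_mult_mod_eq[of "length w" n] by simp
    moreover have "n - 1 \<le> length u" using uw(1) by (metis mod_less_eq_dividend)
    ultimately show False using less by simp
  qed
  then have "n \<le> length w div n * n" by simp
  then show ?thesis using uw(2) div_mult_mod_eq[of "length w" n] by linarith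
qed

theorem theorem10:
  shows "(\<forall>(M :: ('q, 'a) automaton) n.
            dfa M \<and> card (states M) = n \<and> \<not> prefix_convex (dfa_lang M) \<longrightarrow>
            (\<exists>u v w. convexity_failure_witness (dfa_lang M) u v w \<and> length w \<le> 2 * n - 1))
       \<and> (\<forall>n \<ge> 2. \<exists>M :: (nat, 'b) automaton.
            dfa M \<and> card (states M) = n \<and> card (alphabet M) = 1 \<and>
            \<not> prefix_convex (dfa_lang M) \<and>
            (\<forall>u v w. convexity_failure_witness (dfa_lang M) u v w \<longrightarrow> length w \<ge> 2 * n - 1))"
proof (intro conjI allI impI)
  fix M :: "('q, 'a) automaton" and n
  assume "dfa M \<and> card (states M) = n \<and> \<not> prefix_convex (dfa_lang M)"
  then show "\<exists>u v w. convexity_failure_witness (dfa_lang M) u v w \<and> length w \<le> 2 * n - 1"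
    using dfa.short_convexity_failure_witness by blast
next
  fix n :: nat
  assume n: "n \<ge> 2"
  let ?M = "cycle_dfa n :: (nat, 'b) automaton"
  have "card (states ?M) = n" "card (alphabet ?M) = 1"
    by (simp_all add: cycle_dfa_def)
  moreover have "n > 0" using n by simp
  ultimately show "\<exists>M :: (nat, 'b) automaton.
            dfa M \<and> card (states M) = n \<and> card (alphabet M) = 1 \<and>
            \<not> prefix_convex (dfa_lang M) \<and>
            (\<forall>u v w. convexity_failure_witness (dfa_lang M) u v w \<longrightarrow> length w \<ge> 2 * n - 1)"
    using dfa_cycle_dfa not_prefix_convex_cycle_dfa[OF n] cycle_dfa_witness_length by blast
qed

end
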